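(* Let $D(t)\in\mathbb{C}[t]$ be nonconstant and let $F(t)\in\mathbb{C}[t]$ be nonzero. Then $F^2D$ is Pellian if and only if $D$ is Pellian, with solutions $(u_n(t),v_n(t))_{n\in\mathbb{Z}}$, and $F(t)\mid v_n(t)$ for some integer $n\neq 0$.
   Context: Pell's equation for a nonconstant $D\in\mathbb{C}[t]$ is $x^2-Dy^2=1$ with $x,y\in\mathbb{C}[t]$. $D$ is called Pellian if it has a solution with $y\neq0$. If $D$ is Pellian, a fundamental solution is a solution $(u,v)$ with $v\neq 0$ of minimal degree among all solutions with $y\neq 0$, and $(u_n,v_n)$ is defined for $n\in\mathbb{Z}$ by $u_n+v_n\sqrt{D}=(u+v\sqrt{D})^n$, where $(u+v\sqrt D)^{-1}=u-v\sqrt D$. *)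

theory Defs
  imports Complex_Main "HOL-Computational_Algebra.Polynomial"
begin

definition pell_solution :: "complex poly \<Rightarrow> complex poly \<Rightarrow> complex poly \<Rightarrow> bool" where
  "pell_solution D x y \<longleftrightarrow> x\<^sup>2 - D * y\<^sup>2 = 1"

definition pellian :: "complex poly \<Rightarrow> bool" where
  "pellian D \<longleftrightarrow> (\<exists>x y. pell_solution D x y \<and> y \<noteq> 0)"

(* The degree of a solution (x, y) is read as the degree of x. For nonconstant D and y \<noteq> 0
   this agrees with minimality of the degree of y, see pell_solution_degree below. *)
definition fundamental_solution :: "complex poly \<Rightarrow> complex poly \<Rightarrow> complex poly \<Rightarrow> bool" where
  "fundamental_solution D u v \<longleftrightarrow>
     pell_solution D u v \<and> v \<noteq> 0 \<and>
     (\<forall>x y. pell_solution D x y \<and> y \<noteq> 0 \<longrightarrow> degree u \<le> degree x)"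

(* The pair (a, b) stands for a + b sqrt(D) in the ring generated by sqrt(D) over the polynomials. *)
definition quad_mult ::
    "complex poly \<Rightarrow> complex poly \<times> complex poly \<Rightarrow> complex poly \<times> complex poly
      \<Rightarrow> complex poly \<times> complex poly" where
  "quad_mult D p q =
     (fst p * fst q + D * snd p * snd q, fst p * snd q + snd p * fst q)"

primrec quad_power ::
    "complex poly \<Rightarrow> complex poly \<times> complex poly \<Rightarrow> nat \<Rightarrow> complex poly \<times> complex poly" where
  "quad_power D p 0 = (1, 0)"
| "quad_power D p (Suc n) = quad_mult D p (quad_power D p n)"

(* (u + v sqrt(D))^n for an integer n, where (u, v) solves Pell's equation; the inverse of
   u + v sqrt(D) is then u - v sqrt(D). *)
definition pell_power ::
    "complex poly \<Rightarrow> complex poly \<Rightarrow> complex poly \<Rightarrow> int \<Rightarrow> complex poly \<times> complex poly" where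
  "pell_power D u v n =
     (if 0 \<le> n then quad_power D (u, v) (nat n) else quad_power D (u, - v) (nat (- n)))"

definition pell_u :: "complex poly \<Rightarrow> complex poly \<Rightarrow> complex poly \<Rightarrow> int \<Rightarrow> complex poly" where
  "pell_u D u v n = fst (pell_power D u v n)"

definition pell_v :: "complex poly \<Rightarrow> complex poly \<Rightarrow> complex poly \<Rightarrow> int \<Rightarrow> complex poly" where
  "pell_v D u v n = snd (pell_power D u v n)"

lemma pell_solution_degree:
  assumes "pell_solution D x y" "y \<noteq> 0" "degree D > 0"
  shows "2 * degree x = degree D + 2 * degree y"
proof -
  have D0: "D \<noteq> 0" using assms(3) by auto
  have eq: "x\<^sup>2 = D * y\<^sup>2 + 1"
    using assms(1) by (simp add: pell_solution_def algebra_simps)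
  have d: "degree (D * y\<^sup>2) = degree D + 2 * degree y"
    using D0 assms(2) by (simp add: degree_mult_eq degree_power_eq)
  have "degree (x\<^sup>2) = degree (D * y\<^sup>2)"
    unfolding eq by (rule degree_add_eq_left) (use d assms(3) in simp)
  moreover have "x \<noteq> 0"
  proof
    assume "x = 0"
    hence "degree (D * y\<^sup>2 + 1) = 0" using eq by simp
    moreover have "degree (D * y\<^sup>2 + 1) = degree (D * y\<^sup>2)"
      by (rule degree_add_eq_left) (use d assms(3) in simp)
    ultimately show False using d assms(3) by simp
  qed
  ultimately show ?thesis using d by (simp add: degree_power_eq)
qed

lemma quad_power_poly:
  assumes "s\<^sup>2 = poly D z"
  shows "poly (fst (quad_power D p n)) z + poly (snd (quad_power D p n)) z * s
         = (poly (fst p) z + poly (snd p) z * s) ^ n"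
proof (induction n)
  case (Suc n)
  let ?q = "quad_power D p n"
  have "poly (fst (quad_mult D p ?q)) z + poly (snd (quad_mult D p ?q)) z * s
      = (poly (fst p) z + poly (snd p) z * s) * (poly (fst ?q) z + poly (snd ?q) z * s)"
    by (simp add: quad_mult_def assms[symmetric] power2_eq_square algebra_simps)
  then show ?case using Suc by simp
qed simp

(* Pointwise form of the defining identity u_n + v_n sqrt(D) = (u + v sqrt(D))^n;
   it holds for both square roots s of D(z) at every z. *)
lemma pell_power_poly:
  assumes "pell_solution D u v" "s\<^sup>2 = poly D z"
  shows "poly (pell_u D u v n) z + poly (pell_v D u v n) z * s
         = (poly u z + poly v z * s) powi n"
proof -
  have "poly (u\<^sup>2 - D * v\<^sup>2) z = 1" using assms(1) by (simp add: pell_solution_def)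
  hence "(poly u z + poly v z * s) * (poly u z - poly v z * s) = 1"
    by (simp add: assms(2)[symmetric] power2_eq_square algebra_simps)
  hence inv: "inverse (poly u z + poly v z * s) = poly u z - poly v z * s"
    by (rule inverse_unique)
  show ?thesis
    using quad_power_poly[OF assms(2), of "(u, v)" "nat n"]
      quad_power_poly[OF assms(2), of "(u, - v)" "nat (- n)"]
    by (simp add: pell_u_def pell_v_def pell_power_def power_int_def inv)
qed

end

theory Submission
  imports Defs
begin

text \<open>
  A solution \<open>(x, y)\<close> for \<open>F\<^sup>2 D\<close> is the same as a solution \<open>(x, F y)\<close> for \<open>D\<close>. So the claim
  reduces to the structure of the solutions for \<open>D\<close>: each of them is \<open>\<plusminus> (u\<^sub>n, v\<^sub>n)\<close> for some \<open>n\<close>,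
  and \<open>v\<^sub>n \<noteq> 0\<close> for \<open>n \<noteq> 0\<close>. The first fact is a descent on the degree of \<open>x\<close>: the elements
  \<open>x u \<plusminus> D y v\<close> have product \<open>x\<^sup>2 + u\<^sup>2 - 1\<close> and sum \<open>2 x u\<close>, so one of them has degree at most
  \<open>deg x - deg u\<close>. The second holds because \<open>v\<^sub>n / v\<close> is congruent to \<open>n\<close> modulo \<open>u - 1\<close>.
\<close>

lemma pell_solution_iff: "pell_solution D x y \<longleftrightarrow> x * x = 1 + D * y * y"
  by (auto simp: pell_solution_def power2_eq_square algebra_simps)

lemma pell_solution_degree_pos:
  assumes "pell_solution D x y" "y \<noteq> 0" "degree D > 0"
  shows "degree x > 0"
  using pell_solution_degree[OF assms] assms(3) by linarith

lemma pell_solution_uminus_right: "pell_solution D u (- v) \<longleftrightarrow> pell_solution D u v"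
  by (simp add: pell_solution_def)

lemma pell_solution_mult:
  assumes "pell_solution D a b" "pell_solution D c d"
  shows "pell_solution D (a * c + D * b * d) (a * d + b * c)"
proof -
  have "(a * c + D * b * d)\<^sup>2 - D * (a * d + b * c)\<^sup>2 = (a\<^sup>2 - D * b\<^sup>2) * (c\<^sup>2 - D * d\<^sup>2)"
    by algebra
  then show ?thesis
    using assms by (simp add: pell_solution_def)
qed

text \<open>The norm \<open>u * u - D * v * v\<close> is 1, so the conjugate \<open>(u, - v)\<close>
  is the inverse of \<open>(u, v)\<close>.\<close>

lemma quad_mult_conj_cancel:
  assumes "pell_solution D u v"
  shows "quad_mult D (u, v) (quad_mult D (u, - v) p) = p"
proof -
  have N: "u * u - D * v * v = 1"
    using assms by (simp add: pell_solution_iff)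
  have "quad_mult D (u, v) (quad_mult D (u, - v) p)
      = ((u * u - D * v * v) * fst p, (u * u - D * v * v) * snd p)"
    by (simp add: quad_mult_def algebra_simps)
  then show ?thesis by (simp add: N)
qed

lemma pell_solution_quad_power:
  assumes "pell_solution D u v"
  shows "pell_solution D (fst (quad_power D (u, v) n)) (snd (quad_power D (u, v) n))"
proof (induction n)
  case 0
  show ?case by (simp add: pell_solution_def)
next
  case (Suc n)
  show ?case
    using pell_solution_mult[OF assms Suc] by (simp add: quad_mult_def)
qed

lemma pell_solution_pell_power:
  assumes "pell_solution D u v"
  shows "pell_solution D (pell_u D u v n) (pell_v D u v n)"
  using assms pell_solution_quad_power
  by (simp add: pell_u_def pell_v_def pell_power_def pell_solution_uminus_right)

lemma pell_power_add_one:
  assumes "pell_solution D u v"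
  shows "pell_power D u v (n + 1) = quad_mult D (u, v) (pell_power D u v n)"
proof (cases "0 \<le> n")
  case True
  then show ?thesis by (simp add: pell_power_def nat_add_distrib)
next
  case False
  then obtain k where k: "nat (- n) = Suc k"
    by (cases "nat (- n)") auto
  \<comment> \<open>For \<open>k = 0\<close> the exponent \<open>n + 1\<close> is 0 and falls under
    the nonnegative branch of \<open>pell_power\<close>; both branches give \<open>(1, 0)\<close>
    there.\<close>
  then have "pell_power D u v (n + 1) = quad_power D (u, - v) k"
    using False by (cases "k = 0") (auto simp: pell_power_def nat_diff_distrib)
  then show ?thesis
    using False k by (simp add: pell_power_def quad_mult_conj_cancel[OF assms])
qed

lemma pell_power_diff_one:
  assumes "pell_solution D u v"
  shows "pell_power D u v (n - 1) = quad_mult D (u, - v) (pell_power D u v n)"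
  using pell_power_add_one[OF assms, of "n - 1"]
    quad_mult_conj_cancel[of D u "- v"] assms
  by (simp add: pell_solution_uminus_right)

text \<open>Since \<open>D * v * v = (u - 1) * (u + 1)\<close>, multiplication by
  \<open>(u, v)\<close> acts modulo \<open>u - 1\<close> on pairs \<open>(a, v * w)\<close> as
  \<open>a \<mapsto> a\<close>, \<open>w \<mapsto> a + w\<close>. The congruence for the first
  component is carried along because the step for \<open>w\<close> needs it.\<close>

lemma quad_power_cong_mod_u_minus_one:
  assumes "pell_solution D u v"
  shows "\<exists>w. snd (quad_power D (u, v) n) = v * w \<and> u - 1 dvd w - of_nat n
           \<and> u - 1 dvd fst (quad_power D (u, v) n) - 1"
proof (induction n)
  case 0
  show ?case by (rule exI[of _ 0]) simp
next
  case (Suc n)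
  let ?a = "fst (quad_power D (u, v) n)"
  obtain w where w: "snd (quad_power D (u, v) n) = v * w" "u - 1 dvd w - of_nat n"
      "u - 1 dvd ?a - 1"
    using Suc by blast
  have N: "D * v * v = u * u - 1"
    using assms by (simp add: pell_solution_iff)
  have "snd (quad_power D (u, v) (Suc n)) = v * (?a + u * w)"
    by (simp add: quad_mult_def w(1) algebra_simps)
  moreover have "u - 1 dvd ?a + u * w - of_nat (Suc n)"
  proof -
    have "?a + u * w - of_nat (Suc n) = (?a - 1) + (u - 1) * w + (w - of_nat n)"
      by (simp add: algebra_simps)
    then show ?thesis using w by (metis dvd_add dvd_triv_left)
  qed
  moreover have "u - 1 dvd fst (quad_power D (u, v) (Suc n)) - 1"
  proof -
    have "fst (quad_power D (u, v) (Suc n)) = u * ?a + (D * v * v) * w"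
      by (simp add: quad_mult_def w(1) algebra_simps)
    then have "fst (quad_power D (u, v) (Suc n)) - 1
        = u * (?a - 1) + (u - 1) * (1 + (u + 1) * w)"
      unfolding N by (simp add: algebra_simps)
    then show ?thesis using w(3) by (metis dvd_add dvd_mult dvd_triv_left)
  qed
  ultimately show ?case by blast
qed

text \<open>Otherwise \<open>w = 0\<close>, so \<open>u - 1\<close>, of positive degree, would
  divide the nonzero constant \<open>n\<close>.\<close>

lemma snd_quad_power_nonzero:
  assumes "pell_solution D u v" "v \<noteq> 0" "degree D > 0" "n > 0"
  shows "snd (quad_power D (u, v) n) \<noteq> 0"
proof
  assume 0: "snd (quad_power D (u, v) n) = 0"
  obtain w where "snd (quad_power D (u, v) n) = v * w" "u - 1 dvd w - of_nat n"
    using quad_power_cong_mod_u_minus_one[OF assms(1)] by blast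
  then have "u - 1 dvd (of_nat n :: complex poly)"
    using 0 assms(2) by simp
  then have "degree (u - 1) \<le> degree (of_nat n :: complex poly)"
    by (rule dvd_imp_degree_le) (use assms(4) in simp)
  moreover have "degree (u - 1) = degree u"
    using degree_add_eq_left[of "- 1" u] pell_solution_degree_pos[OF assms(1-3)] by simp
  ultimately show False
    using pell_solution_degree_pos[OF assms(1-3)] by simp
qed

lemma pell_v_nonzero:
  assumes "pell_solution D u v" "v \<noteq> 0" "degree D > 0" "n \<noteq> 0"
  shows "pell_v D u v n \<noteq> 0"
  using snd_quad_power_nonzero[of D u v "nat n"] snd_quad_power_nonzero[of D u "- v" "nat (- n)"]
    assms by (auto simp: pell_v_def pell_power_def pell_solution_uminus_right)

text \<open>The degree of the product is the sum of the minimum and the maximum of the two degrees,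
  and the maximum bounds the degree of \<open>p + q\<close>.\<close>

lemma degree_min_of_sum_prod:
  fixes p q :: "'a::idom poly"
  assumes "p * q \<noteq> 0"
  shows "min (degree p) (degree q) + degree (p + q) \<le> degree (p * q)"
  using degree_add_le_max[of p q] assms by (auto simp: degree_mult_eq min_def max_def)

lemma pell_descent:
  assumes uv: "pell_solution D u v" "v \<noteq> 0" and xy: "pell_solution D x y" "y \<noteq> 0"
    and D: "degree D > 0" and le: "degree u \<le> degree x"
  shows "degree (x * u - D * y * v) < degree x \<or> degree (x * u + D * y * v) < degree x"
proof -
  let ?p = "x * u - D * y * v" and ?q = "x * u + D * y * v"
  have u: "degree u > 0" and x: "degree x > 0"
    using pell_solution_degree_pos uv xy D by auto
  have U: "D * v * v = u * u - 1" and X: "D * y * y = x * x - 1"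
    using uv(1) xy(1) by (simp_all add: pell_solution_iff)
  have "?p * ?q = x * x * (u * u) - (D * y * y) * (D * v * v)"
    by (simp add: algebra_simps)
  also have "\<dots> = x * x + u * u - 1"
    unfolding U X by (simp add: algebra_simps)
  finally have pq: "?p * ?q = x * x + u * u - 1" .
  have "degree (?p * ?q) \<le> 2 * degree x"
    unfolding pq using le
    by (intro degree_diff_le degree_add_le) (auto intro: order.trans[OF degree_mult_le])
  moreover have "degree (?p + ?q) = degree x + degree u"
  proof -
    have "?p + ?q = smult 2 (x * u)"
      by (simp add: numeral_poly algebra_simps flip: mult_2)
    moreover have "x \<noteq> 0" "u \<noteq> 0" using u x by auto
    ultimately show ?thesis by (simp add: degree_mult_eq)
  qed
  moreover have "min (degree ?p) (degree ?q) + degree (?p + ?q) \<le> degree (?p * ?q)" if "?p * ?q \<noteq> 0"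
    using that by (rule degree_min_of_sum_prod)
  \<comment> \<open>If the product vanishes, one factor is 0 and has degree 0. Otherwise the smaller
    degree is at most \<open>degree x - degree u\<close>.\<close>
  ultimately show ?thesis
    using u x by (cases "?p * ?q = 0") auto
qed

lemma pell_solution_eq_pm_power:
  assumes uv: "fundamental_solution D u v" and D: "degree D > 0"
    and xy: "pell_solution D x y"
  shows "\<exists>n. (x, y) = pell_power D u v n \<or> (- x, - y) = pell_power D u v n"
  using xy
proof (induction "degree x" arbitrary: x y rule: less_induct)
  case less
  have sol: "pell_solution D u v" and v: "v \<noteq> 0"
    using uv by (auto simp: fundamental_solution_def)
  have sol': "pell_solution D u (- v)"
    using sol by (simp add: pell_solution_uminus_right)
  show ?case
  proof (cases "y = 0")
    case True
    then have "x = 1 \<or> x = - 1"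
      using less.prems by (simp add: pell_solution_def power2_eq_1_iff)
    then show ?thesis
      using True by (auto intro!: exI[of _ 0] simp: pell_power_def)
  next
    case False
    \<comment> \<open>Minimality of the fundamental solution enters only here; it makes the descent
      applicable.\<close>
    then have "degree u \<le> degree x"
      using uv less.prems by (auto simp: fundamental_solution_def)
    then consider "degree (u * x + D * (- v) * y) < degree x" | "degree (u * x + D * v * y) < degree x"
      using pell_descent[OF sol v less.prems False D] by (auto simp: algebra_simps)
    then show ?thesis
    proof cases
      case 1
      \<comment> \<open>The first component of \<open>?z\<close> is the one of smaller degree;
        multiplying back by the inverse factor raises the exponent by one and commutes with the
        sign.\<close>
      let ?z = "quad_mult D (u, - v) (x, y)"
      have cancel: "quad_mult D (u, v) ?z = (x, y)"
        by (rule quad_mult_conj_cancel[OF sol])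
      have "pell_solution D (fst ?z) (snd ?z)"
        using pell_solution_mult[OF sol' less.prems] by (simp add: quad_mult_def)
      then obtain n where "?z = pell_power D u v n \<or> (- fst ?z, - snd ?z) = pell_power D u v n"
        using less.hyps[of "fst ?z" "snd ?z"] 1 by (auto simp: quad_mult_def)
      moreover have "quad_mult D (u, v) (- fst ?z, - snd ?z) = (- x, - y)"
        using cancel by (simp add: quad_mult_def prod_eq_iff algebra_simps)
      ultimately show ?thesis
        using cancel pell_power_add_one[OF sol, of n] by metis
    next
      case 2
      let ?z = "quad_mult D (u, v) (x, y)"
      have cancel: "quad_mult D (u, - v) ?z = (x, y)"
        using quad_mult_conj_cancel[OF sol'] by simp
      have "pell_solution D (fst ?z) (snd ?z)"
        using pell_solution_mult[OF sol less.prems] by (simp add: quad_mult_def)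
      then obtain n where "?z = pell_power D u v n \<or> (- fst ?z, - snd ?z) = pell_power D u v n"
        using less.hyps[of "fst ?z" "snd ?z"] 2 by (auto simp: quad_mult_def)
      moreover have "quad_mult D (u, - v) (- fst ?z, - snd ?z) = (- x, - y)"
        using cancel by (simp add: quad_mult_def prod_eq_iff algebra_simps)
      ultimately show ?thesis
        using cancel pell_power_diff_one[OF sol, of n] by metis
    qed
  qed
qed

lemma pell_solution_square_mult: "pell_solution (F\<^sup>2 * D) x y \<longleftrightarrow> pell_solution D x (F * y)"
  by (simp add: pell_solution_def power_mult_distrib algebra_simps)

theorem lemma0p6:
  fixes D F u v :: "complex poly"
  assumes "degree D > 0"
    and "F \<noteq> 0"
    and "pellian D \<Longrightarrow> fundamental_solution D u v"
  shows "pellian (F\<^sup>2 * D) \<longleftrightarrow>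
           pellian D \<and> (\<exists>n::int. n \<noteq> 0 \<and> F dvd pell_v D u v n)"
proof
  assume "pellian (F\<^sup>2 * D)"
  then obtain x y where xy: "pell_solution D x (F * y)" "y \<noteq> 0"
    by (auto simp: pellian_def pell_solution_square_mult)
  then have Fy: "F * y \<noteq> 0" using assms(2) by simp
  \<comment> \<open>This has to come first: \<open>(u, v)\<close> is known to be fundamental only
    once \<open>D\<close> is Pellian.\<close>
  with xy(1) have P: "pellian D" unfolding pellian_def by blast
  obtain n where "(x, F * y) = pell_power D u v n \<or> (- x, - (F * y)) = pell_power D u v n"
    using pell_solution_eq_pm_power[OF assms(3)[OF P] assms(1) xy(1)] by blast
  then have n: "pell_v D u v n = F * y \<or> pell_v D u v n = - (F * y)"
    unfolding pell_v_def by (metis snd_conv)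
  \<comment> \<open>The power with exponent 0 is \<open>(1, 0)\<close>, whose second component is 0,
    unlike \<open>F * y\<close>.\<close>
  have "n \<noteq> 0"
    using n Fy by (auto simp: pell_v_def pell_power_def)
  moreover have "F dvd pell_v D u v n"
    using n by auto
  ultimately show "pellian D \<and> (\<exists>n::int. n \<noteq> 0 \<and> F dvd pell_v D u v n)"
    using P by blast
next
  assume "pellian D \<and> (\<exists>n::int. n \<noteq> 0 \<and> F dvd pell_v D u v n)"
  then obtain n :: int and w where P: "pellian D" and n: "n \<noteq> 0" "pell_v D u v n = F * w"
    by (auto elim!: dvdE)
  have sol: "pell_solution D u v" "v \<noteq> 0"
    using assms(3)[OF P] by (auto simp: fundamental_solution_def)
  have "pell_solution (F\<^sup>2 * D) (pell_u D u v n) w"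
    using pell_solution_pell_power[OF sol(1), of n] n(2) by (simp add: pell_solution_square_mult)
  moreover have "w \<noteq> 0"
    using pell_v_nonzero[OF sol assms(1) n(1)] n(2) by auto
  ultimately show "pellian (F\<^sup>2 * D)"
    by (auto simp: pellian_def)
qed

end
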